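(* For every $n$, $$|\mathcal{ODP}_n| = 3\cdot 2^n-2(n+1).$$
   Context: For $n\ge 0$ let $X_n=\{1,2,\dots,n\}$ and let $\mathcal{I}_n$ be the set of all partial injective maps of $X_n$ (including the empty map). $\mathcal{ODP}_n$ is the set of all $\alpha\in\mathcal{I}_n$ such that for all $x,y\in\mathrm{Dom}\,\alpha$, $|x-y|=|x\alpha-y\alpha|$, and $x\le y$ implies $x\alpha\le y\alpha$ (order-preserving partial isometries; $x\alpha$ denotes the image of $x$ under $\alpha$). *)

theory Defs
  imports Main
begin

definition X :: "nat \<Rightarrow> nat set" where
  "X n = {1..n}"

text \<open>
  A partial map of \<open>X n\<close> is a map \<open>\<alpha> :: nat \<rightharpoonup> nat\<close> whose domain and range lie in \<open>X n\<close>;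
  the empty map is \<open>\<lambda>_. None\<close>.
\<close>

definition partial_injections :: "nat \<Rightarrow> (nat \<rightharpoonup> nat) set" where
  "partial_injections n = {\<alpha>. dom \<alpha> \<subseteq> X n \<and> ran \<alpha> \<subseteq> X n \<and> inj_on \<alpha> (dom \<alpha>)}"

text \<open>Distances are computed in \<^typ>\<open>int\<close>, since subtraction on \<^typ>\<open>nat\<close> truncates.\<close>

definition ODP :: "nat \<Rightarrow> (nat \<rightharpoonup> nat) set" where
  "ODP n = {\<alpha> \<in> partial_injections n.
     \<forall>x \<in> dom \<alpha>. \<forall>y \<in> dom \<alpha>.
       \<bar>int x - int y\<bar> = \<bar>int (the (\<alpha> x)) - int (the (\<alpha> y))\<bar> \<and>
       (x \<le> y \<longrightarrow> the (\<alpha> x) \<le> the (\<alpha> y))}"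

end

theory Submission
  imports Defs
begin

text \<open>
  An order-preserving partial isometry is a restriction of a translation \<open>x \<mapsto> x + d\<close>, and the
  shift \<open>d\<close> is determined by the map as soon as its domain is nonempty. The points of \<open>X n\<close> which
  the shift \<open>d\<close> keeps inside \<open>X n\<close> number \<open>n - \<bar>d\<bar>\<close>, so there are \<open>2 ^ (n - \<bar>d\<bar>) - 1\<close> nonempty
  maps with shift \<open>d\<close>; it remains to sum over \<open>\<bar>d\<bar> \<le> n\<close> and to add the empty map.
\<close>

text \<open>The shift is an integer because it may be negative. For \<open>A\<close> inside
  \<open>shift_dom n d\<close> all values \<open>int x + d\<close> are positive, so
  \<open>nat\<close> truncates nothing.\<close>

definition shift_map :: "int \<Rightarrow> nat set \<Rightarrow> nat \<rightharpoonup> nat" where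
  "shift_map d A = (\<lambda>x. if x \<in> A then Some (nat (int x + d)) else None)"

definition shift_dom :: "nat \<Rightarrow> int \<Rightarrow> nat set" where
  "shift_dom n d = {x \<in> X n. 1 \<le> int x + d \<and> int x + d \<le> int n}"

lemma dom_shift_map [simp]: "dom (shift_map d A) = A"
  by (auto simp: shift_map_def dom_def)

lemma shift_map_empty: "shift_map d {} = Map.empty"
  by (simp add: shift_map_def)

lemma finite_shift_dom: "finite (shift_dom n d)"
  by (simp add: shift_dom_def X_def)

lemma card_shift_dom: "card (shift_dom n d) = nat (int n - \<bar>d\<bar>)"
proof -
  \<comment> \<open>For \<bar>d\<bar> \<ge> n this interval is empty, in agreement with
    \<open>nat\<close> cutting off at 0.\<close>
  have "shift_dom n d = {nat (max 1 (1 - d)) .. nat (min (int n) (int n - d))}"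
    by (auto simp: shift_dom_def X_def)
  then show ?thesis by auto
qed

lemma shift_map_in_ODP:
  assumes "A \<subseteq> shift_dom n d"
  shows "shift_map d A \<in> ODP n"
proof -
  have val: "the (shift_map d A x) = nat (int x + d)" "1 \<le> int x + d" "int x + d \<le> int n"
    "x \<in> X n" if "x \<in> A" for x
    using that assms by (auto simp: shift_map_def shift_dom_def)
  have "ran (shift_map d A) \<subseteq> X n"
    using val by (fastforce simp: ran_def shift_map_def X_def split: if_splits)
  moreover have "inj_on (shift_map d A) A"
    using val(2) by (fastforce simp: inj_on_def shift_map_def nat_eq_iff)
  ultimately show ?thesis
    using val by (force simp: ODP_def partial_injections_def)
qed

lemma ODP_shift_mapE:
  assumes "\<alpha> \<in> ODP n" "dom \<alpha> \<noteq> {}"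
  obtains d where "\<bar>d\<bar> \<le> int n" "dom \<alpha> \<subseteq> shift_dom n d" "\<alpha> = shift_map d (dom \<alpha>)"
proof -
  from assms(2) obtain a where a: "a \<in> dom \<alpha>" by blast
  define d where "d = int (the (\<alpha> a)) - int a"
  have X: "x \<in> X n" "the (\<alpha> x) \<in> X n" if "x \<in> dom \<alpha>" for x
    using that assms(1) by (auto simp: ODP_def partial_injections_def ran_def)
  have iso: "\<bar>int x - int y\<bar> = \<bar>int (the (\<alpha> x)) - int (the (\<alpha> y))\<bar>"
    and mono: "x \<le> y \<Longrightarrow> the (\<alpha> x) \<le> the (\<alpha> y)" if "x \<in> dom \<alpha>" "y \<in> dom \<alpha>" for x y
    using that assms(1) unfolding ODP_def by blast+
  \<comment> \<open>The distance to \<open>a\<close> leaves two candidates for the image of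
    \<open>x\<close>, mirror images of each other about the image of \<open>a\<close>; monotonicity,
    applied in both directions, selects the one on the same side as \<open>x\<close>.\<close>
  have val: "int (the (\<alpha> x)) = int x + d" if "x \<in> dom \<alpha>" for x
    using iso[OF that a] mono[OF that a] mono[OF a that] unfolding d_def by linarith
  show thesis
  proof
    show "\<bar>d\<bar> \<le> int n" using X[OF a] by (auto simp: d_def X_def)
    show "dom \<alpha> \<subseteq> shift_dom n d"
      using X val by (fastforce simp: shift_dom_def X_def)
    show "\<alpha> = shift_map d (dom \<alpha>)"
    proof
      fix x
      show "\<alpha> x = shift_map d (dom \<alpha>) x"
      proof (cases "x \<in> dom \<alpha>")
        case True
        then show ?thesis using val[OF True] by (auto simp: shift_map_def)
      next
        case False
        then show ?thesis by (auto simp: shift_map_def)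
      qed
    qed
  qed
qed

text \<open>The domain of the map recovers \<open>A\<close>, and its value at any point of
  \<open>A\<close> recovers \<open>d\<close>. The empty set is excluded because every shift
  restricts to the same empty map.\<close>

lemma inj_on_shift_map:
  "inj_on (\<lambda>(d, A). shift_map d A) (SIGMA d:D. Pow (shift_dom n d) - {{}})"
proof -
  have "d = e \<and> A = B" if A: "A \<subseteq> shift_dom n d" "A \<noteq> {}" and B: "B \<subseteq> shift_dom n e"
    and eq: "shift_map d A = shift_map e B" for d A e B
  proof -
    from arg_cong[OF eq, of dom] have "A = B" by simp
    obtain x where x: "x \<in> A" "x \<in> B" using A(2) \<open>A = B\<close> by blast
    then have "1 \<le> int x + d" "1 \<le> int x + e"
      using A B by (auto simp: shift_dom_def)
    moreover have "nat (int x + d) = nat (int x + e)"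
      using fun_cong[OF eq, of x] x by (simp add: shift_map_def)
    ultimately have "d = e" by simp
    then show ?thesis using \<open>A = B\<close> by blast
  qed
  then show ?thesis by (intro inj_onI) (clarify, blast)
qed

lemma ODP_eq:
  "ODP n = insert Map.empty
     ((\<lambda>(d, A). shift_map d A) ` (SIGMA d:{- int n..int n}. Pow (shift_dom n d) - {{}}))"
  (is "_ = insert _ ?S")
proof
  show "ODP n \<subseteq> insert Map.empty ?S"
  proof
    fix \<alpha> assume \<alpha>: "\<alpha> \<in> ODP n"
    show "\<alpha> \<in> insert Map.empty ?S"
    proof (cases "dom \<alpha> = {}")
      case False
      with \<alpha> obtain d where "\<bar>d\<bar> \<le> int n" "dom \<alpha> \<subseteq> shift_dom n d" "\<alpha> = shift_map d (dom \<alpha>)"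
        by (rule ODP_shift_mapE)
      with False have "(d, dom \<alpha>) \<in> (SIGMA d:{- int n..int n}. Pow (shift_dom n d) - {{}})"
        by auto
      moreover have "\<alpha> = (\<lambda>(d, A). shift_map d A) (d, dom \<alpha>)"
        using \<open>\<alpha> = _\<close> by simp
      ultimately show ?thesis by blast
    qed auto
  qed
  show "insert Map.empty ?S \<subseteq> ODP n"
    \<comment> \<open>The instance with empty domain, here with shift 0, accounts for the empty
      map.\<close>
    using shift_map_in_ODP[of "{}" n 0] by (auto simp: shift_map_empty intro: shift_map_in_ODP)
qed

text \<open>By induction: in passing from \<open>n\<close> to \<open>Suc n\<close> the two new
  extreme terms are 2 ^ 0 - 1 = 0, and each of the 2n + 1 old terms t becomes 2t + 1. Hence S(n + 1)
  = 2 S(n) + 2n + 1.\<close>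

lemma sum_shifts:
  "(\<Sum>d\<in>{- int n..int n}. 2 ^ nat (int n - \<bar>d\<bar>) - 1 :: int) = 3 * 2 ^ n - 2 * int n - 3"
proof (induction n)
  case (Suc n)
  have "{- int (Suc n)..int (Suc n)} =
      insert (- int (Suc n)) (insert (int (Suc n)) {- int n..int n})"
    by auto
  then have "(\<Sum>d\<in>{- int (Suc n)..int (Suc n)}. 2 ^ nat (int (Suc n) - \<bar>d\<bar>) - 1 :: int) =
      (\<Sum>d\<in>{- int n..int n}. 2 ^ nat (int (Suc n) - \<bar>d\<bar>) - 1)"
    by simp
  also have "\<dots> = (\<Sum>d\<in>{- int n..int n}. 2 * (2 ^ nat (int n - \<bar>d\<bar>) - 1) + 1)"
  proof (rule sum.cong)
    fix d assume "d \<in> {- int n..int n}"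
    then have "nat (int (Suc n) - \<bar>d\<bar>) = Suc (nat (int n - \<bar>d\<bar>))" by auto
    then show "2 ^ nat (int (Suc n) - \<bar>d\<bar>) - 1 = 2 * (2 ^ nat (int n - \<bar>d\<bar>) - 1) + (1::int)"
      by simp
  qed simp
  also have "\<dots> = 2 * (\<Sum>d\<in>{- int n..int n}. 2 ^ nat (int n - \<bar>d\<bar>) - 1) + (2 * int n + 1)"
    by (simp only: sum.distrib sum_distrib_left[symmetric]) simp
  also have "\<dots> = 3 * 2 ^ Suc n - 2 * int (Suc n) - 3"
    unfolding Suc.IH by simp
  finally show ?case .
qed simp

theorem theorem3p6:
  fixes n :: nat
  shows "int (card (ODP n)) = 3 * 2 ^ n - 2 * (int n + 1)"
proof -
  let ?S = "SIGMA d:{- int n..int n}. Pow (shift_dom n d) - {{}}"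
  let ?f = "\<lambda>(d, A). shift_map d A"
  have "finite ?S" by (intro finite_SigmaI) (simp_all add: finite_shift_dom)
  \<comment> \<open>This keeps the empty map out of the image, so that inserting it adds exactly one
    element.\<close>
  have nonempty: "dom \<alpha> \<noteq> {}" if "\<alpha> \<in> ?f ` ?S" for \<alpha>
    using that by (elim imageE) (clarsimp simp del: dom_eq_empty_conv)
  have "card (ODP n) = card (insert Map.empty (?f ` ?S))"
    by (subst ODP_eq) (rule refl)
  also have "\<dots> = Suc (card (?f ` ?S))"
    using nonempty[of Map.empty] \<open>finite ?S\<close> by (intro card_insert_disjoint finite_imageI notI) simp_all
  also have "card (?f ` ?S) = card ?S"
    by (rule card_image[OF inj_on_shift_map])
  also have "card ?S = (\<Sum>d\<in>{- int n..int n}. card (Pow (shift_dom n d) - {{}}))"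
    by (rule card_SigmaI) (simp_all add: finite_shift_dom)
  also have "\<dots> = (\<Sum>d\<in>{- int n..int n}. 2 ^ nat (int n - \<bar>d\<bar>) - 1)"
    by (rule sum.cong) (simp_all add: card_Pow finite_shift_dom card_shift_dom)
  \<comment> \<open>The differences so far are taken in \<open>nat\<close>; since each power of 2 is
    at least 1, they carry over to \<open>int\<close> unchanged.\<close>
  finally have "int (card (ODP n)) = 1 + (\<Sum>d\<in>{- int n..int n}. 2 ^ nat (int n - \<bar>d\<bar>) - 1)"
    by (simp add: of_nat_diff)
  then show ?thesis unfolding sum_shifts by simp
qed

end
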